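(* Let $n\ge 1$, let Bob's string $B$ be $\mathrm{HH}\cdots\mathrm{H}$ (length $n$, all letters $\mathrm{H}$), and let $A=A_1\cdots A_n\neq B$ be Alice's string over $\{\mathrm{H},\mathrm{T}\}$. In the No-Flippancy game with these strings: (i) Bob wins if and only if $n$ is even and $A$ is the same as $B$ except for the last letter (that is, $A_i=\mathrm{H}$ for $i<n$ and $A_n=\mathrm{T}$). (ii) If it is not the case that $n$ is even and $A=\mathrm{HH}\cdots\mathrm{HT}$, then Alice wins if and only if $A$ has $\mathrm{H}$s in all even positions or $\mathrm{H}$s in all odd positions (that is, $A_i=\mathrm{H}$ for every even $i\in\{1,\dots,n\}$, or $A_i=\mathrm{H}$ for every odd $i\in\{1,\dots,n\}$). (iii) In all other cases the game is infinite.
   Context: No-Flippancy game: Alice and Bob have distinct strings $A=A_1\cdots A_n$ and $B=B_1\cdots B_n$ of the same length $n$ over the alphabet $\{\mathrm{H},\mathrm{T}\}$. Starting from the empty sequence, the players alternate turns, Alice going first, and on each turn the current player appends one letter to the sequence (the game output) as follows: let $i<n$ be the maximal length of a suffix of the current sequence that coincides with a prefix of the current player's string ($i=0$ is allowed, via the empty suffix); the player appends the letter with index $i+1$ of their own string. The game ends as soon as $A$ or $B$ appears as a block of consecutive letters in the sequence (necessarily as its suffix, no matter who made the last move); the player whose string appears first wins. If neither string ever appears, the game is infinite. *)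

theory Defs
  imports "HOL-Library.Sublist"
begin

datatype letter = H | T

(* The maximal i < n such that the last i letters of s are the first i letters of X;
   i = 0 always qualifies when X is nonempty. *)
definition overlap :: "letter list \<Rightarrow> letter list \<Rightarrow> nat" where
  "overlap X s = Max {i. i < length X \<and> suffix (take i X) s}"

(* List indexing starts at 0, so the letter with (1-based) index overlap X s + 1 is
   at list position overlap X s. *)
definition next_letter :: "letter list \<Rightarrow> letter list \<Rightarrow> letter" where
  "next_letter X s = X ! overlap X s"

definition game_over :: "letter list \<Rightarrow> letter list \<Rightarrow> letter list \<Rightarrow> bool" where
  "game_over A B s \<longleftrightarrow> sublist A s \<or> sublist B s"

(* The game output after k turns.  Alice moves when the number of turns made so far is even.
   Once the game has ended, the output no longer changes. *)
fun game_output :: "letter list \<Rightarrow> letter list \<Rightarrow> nat \<Rightarrow> letter list" where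
  "game_output A B 0 = []"
| "game_output A B (Suc k) =
     (let s = game_output A B k in
      if game_over A B s then s
      else s @ [next_letter (if even k then A else B) s])"

definition alice_wins :: "letter list \<Rightarrow> letter list \<Rightarrow> bool" where
  "alice_wins A B \<longleftrightarrow>
     (\<exists>k. sublist A (game_output A B k) \<and> (\<forall>j\<le>k. \<not> sublist B (game_output A B j)))"

definition bob_wins :: "letter list \<Rightarrow> letter list \<Rightarrow> bool" where
  "bob_wins A B \<longleftrightarrow>
     (\<exists>k. sublist B (game_output A B k) \<and> (\<forall>j\<le>k. \<not> sublist A (game_output A B j)))"

definition infinite_game :: "letter list \<Rightarrow> letter list \<Rightarrow> bool" where
  "infinite_game A B \<longleftrightarrow> (\<forall>k. \<not> game_over A B (game_output A B k))"

(* The letter with 1-based index i, for i in {1..length X}. *)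
definition letter_at :: "letter list \<Rightarrow> nat \<Rightarrow> letter" where
  "letter_at X i = X ! (i - 1)"

definition heads_at_even :: "letter list \<Rightarrow> bool" where
  "heads_at_even X \<longleftrightarrow> (\<forall>i\<in>{1..length X}. even i \<longrightarrow> letter_at X i = H)"

definition heads_at_odd :: "letter list \<Rightarrow> bool" where
  "heads_at_odd X \<longleftrightarrow> (\<forall>i\<in>{1..length X}. odd i \<longrightarrow> letter_at X i = H)"

end

theory Submission
  imports Defs
begin

text \<open>
  Bob always appends H, so the output has H in every even position and any block of it has H in
  all even or all odd positions; hence Alice can only win with such a string. Conversely, if A has
  H in its even positions, the output is A itself; if A has H in its odd positions, the output is
  H followed by A, unless it reaches n letters H first. Finally, if the first T of A is not its
  last letter, Bob never wins: when the output ends with m letters H and m is at least the number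
  of letters before that T, Alice appends H only if her overlap exceeds m. To complete n letters H
  without completing A, the players would need such an append by Alice at an m too large for this.
\<close>

section \<open>Overlaps and the letters they produce\<close>

lemma sublist_length_ge_eq:
  assumes "sublist xs ys" "length ys \<le> length xs"
  shows "xs = ys"
  using assms by (auto simp: sublist_def)

lemma overlap_less_length: "X \<noteq> [] \<Longrightarrow> overlap X s < length X"
  and overlap_suffix: "X \<noteq> [] \<Longrightarrow> suffix (take (overlap X s) X) s"
proof -
  assume "X \<noteq> []"
  then have "0 \<in> {i. i < length X \<and> suffix (take i X) s}"
    by simp
  then have "overlap X s \<in> {i. i < length X \<and> suffix (take i X) s}"
    unfolding overlap_def by (intro Max_in) auto
  then show "overlap X s < length X" "suffix (take (overlap X s) X) s"
    by auto
qed

lemma overlap_ge: "i < length X \<Longrightarrow> suffix (take i X) s \<Longrightarrow> i \<le> overlap X s"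
  unfolding overlap_def by (rule Max_ge) auto

lemma overlap_le_length: "X \<noteq> [] \<Longrightarrow> overlap X s \<le> length s"
  using overlap_suffix[of X s] overlap_less_length[of X s] by (auto dest: suffix_length_le)

lemma overlap_take: "k < length X \<Longrightarrow> overlap X (take k X) = k"
  using overlap_ge[of k X "take k X"] overlap_le_length[of X "take k X"]
  by (cases "X = []") auto

text \<open>Each move extends the matched prefix by one letter, so a move made at overlap
  \<open>length X - 1\<close> completes \<open>X\<close>.\<close>

lemma suffix_append_next_letter:
  assumes "X \<noteq> []"
  shows "suffix (take (Suc (overlap X s)) X) (s @ [next_letter X s])"
  using overlap_suffix[OF assms, of s] overlap_less_length[OF assms, of s]
  by (auto simp: take_Suc_conv_app_nth next_letter_def suffix_def)

lemma next_letter_replicate [simp]: "n \<noteq> 0 \<Longrightarrow> next_letter (replicate n x) s = x"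
  using overlap_less_length[of "replicate n x" s] by (simp add: next_letter_def)

section \<open>Parity of positions, flipped between indices starting at 1 and at 0\<close>

lemma heads_at_even_iff: "heads_at_even X \<longleftrightarrow> (\<forall>i<length X. odd i \<longrightarrow> X ! i = H)"
  unfolding heads_at_even_def letter_at_def
proof safe
  fix i assume *: "\<forall>i\<in>{1..length X}. even i \<longrightarrow> X ! (i - 1) = H" "i < length X" "odd i"
  from *(2,3) bspec[OF *(1), of "Suc i"] show "X ! i = H" by simp
next
  fix i assume *: "\<forall>i<length X. odd i \<longrightarrow> X ! i = H" "i \<in> {1..length X}" "even i"
  then show "X ! (i - 1) = H" by (cases i) auto
qed

lemma heads_at_odd_iff: "heads_at_odd X \<longleftrightarrow> (\<forall>i<length X. even i \<longrightarrow> X ! i = H)"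
  unfolding heads_at_odd_def letter_at_def
proof safe
  fix i assume *: "\<forall>i\<in>{1..length X}. odd i \<longrightarrow> X ! (i - 1) = H" "i < length X" "even i"
  from *(2,3) bspec[OF *(1), of "Suc i"] show "X ! i = H" by simp
next
  fix i assume *: "\<forall>i<length X. even i \<longrightarrow> X ! i = H" "i \<in> {1..length X}" "odd i"
  then show "X ! (i - 1) = H" by (cases i) auto
qed

lemma game_output_Suc:
  "\<not> game_over A B (game_output A B k) \<Longrightarrow>
    game_output A B (Suc k) =
      game_output A B k @ [next_letter (if even k then A else B) (game_output A B k)]"
  by (simp add: Let_def)

text \<open>A finished game stays finished, so an unfinished one has gained a letter on every turn;
  the letter appended to its output then gets index \<open>k\<close>.\<close>

lemma length_game_output:
  "\<not> game_over A B (game_output A B k) \<Longrightarrow> length (game_output A B k) = k"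
  by (induction k) (auto simp: Let_def split: if_splits)

text \<open>The index is bounded by the length and not by \<open>k\<close>, because the output may
  have stopped growing.\<close>

lemma game_output_odd_nth:
  assumes "n \<noteq> 0" "i < length (game_output A (replicate n H) k)" "odd i"
  shows "game_output A (replicate n H) k ! i = H"
  using assms(2,3)
proof (induction k)
  case (Suc k)
  show ?case
  proof (cases "game_over A (replicate n H) (game_output A (replicate n H) k)")
    case True
    with Suc show ?thesis by simp
  next
    case False
    note len = length_game_output[OF False]
    from Suc False len assms(1) show ?thesis
      by (cases "i = k") (auto simp: game_output_Suc nth_append simp del: game_output.simps)
  qed
qed simp

lemma alice_wins_not_bob_wins: "alice_wins A B \<Longrightarrow> \<not> bob_wins A B"
proof
  assume "alice_wins A B" "bob_wins A B"
  then obtain k l where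
    "sublist A (game_output A B k)" "\<forall>j\<le>k. \<not> sublist B (game_output A B j)"
    "sublist B (game_output A B l)" "\<forall>j\<le>l. \<not> sublist A (game_output A B j)"
    unfolding alice_wins_def bob_wins_def by blast
  then show False
    using nat_le_linear[of k l] by blast
qed

lemma sublist_game_output_heads:
  assumes "n \<noteq> 0" "sublist A (game_output A (replicate n H) k)"
  shows "heads_at_even A \<or> heads_at_odd A"
proof -
  from assms(2) obtain u v where uv: "game_output A (replicate n H) k = u @ A @ v"
    by (auto simp: sublist_def)
  have "A ! i = H" if "i < length A" "odd (length u + i)" for i
    using game_output_odd_nth[OF assms(1), of "length u + i" A k] that
    by (auto simp: uv nth_append)
  \<comment> \<open>An even offset carries odd indices of \<open>A\<close> to odd indices of the
    output; an odd offset carries the even ones there.\<close>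
  then show ?thesis
    by (cases "even (length u)") (auto simp: heads_at_even_iff heads_at_odd_iff)
qed

section \<open>Strings with which Alice wins\<close>

lemma alice_wins_heads_at_even:
  assumes n: "n \<noteq> 0" "length A = n" "A \<noteq> replicate n H" and heads: "heads_at_even A"
  shows "alice_wins A (replicate n H)"
proof -
  have outputs: "game_output A (replicate n H) k = take k A" if "k \<le> n" for k
    using that
  proof (induction k)
    case (Suc k)
    then have IH: "game_output A (replicate n H) k = take k A" and "k < n" by auto
    then have "\<not> game_over A (replicate n H) (take k A)"
      using n(2) by (auto simp: game_over_def dest: sublist_length_le)
    \<comment> \<open>On Alice's turn her overlap with \<open>take k A\<close> is exactly
      \<open>k\<close>; on Bob's turn \<open>k\<close> is odd, where \<open>A\<close> has H.\<close>
    moreover have "next_letter (if even k then A else replicate n H) (take k A) = A ! k"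
      using heads n \<open>k < n\<close> by (auto simp: heads_at_even_iff next_letter_def[of A] overlap_take)
    ultimately show ?case
      using IH n(2) \<open>k < n\<close> by (simp add: take_Suc_conv_app_nth)
  qed simp
  have "\<not> sublist (replicate n H) (take j A)" for j
  proof
    assume "sublist (replicate n H) (take j A)"
    then have "sublist (replicate n H) A"
      using sublist_take by (rule sublist_order.order_trans)
    with sublist_length_ge_eq[of "replicate n H" A] n(2,3) show False by simp
  qed
  then show ?thesis
    unfolding alice_wins_def using outputs n(2) by (intro exI[of _ n]) auto
qed

text \<open>The opening H shifts \<open>A\<close> by one place, so Bob's letters meet its even
  indices. For the excluded string, H followed by the first \<open>n - 1\<close> letters is already
  Bob's string.\<close>

lemma alice_wins_heads_at_odd:
  assumes n: "n \<noteq> 0" "length A = n" "A \<noteq> replicate n H" and heads: "heads_at_odd A"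
    and exceptional: "\<not> (even n \<and> A = replicate (n - 1) H @ [T])"
  shows "alice_wins A (replicate n H)"
proof -
  \<comment> \<open>Each letter is copied from the place before it, starting with H. This is used
    where the output coincides with a prefix of \<open>A\<close>.\<close>
  have eq_replicate: "take k A = replicate k H" if shift: "H # take (k - 1) A = take k A" and "k \<le> n" for k
  proof -
    have "A ! j = H" if "j < k" for j
      using that
    proof (induction j)
      case 0
      have "take k A ! 0 = H" using shift by (metis nth_Cons_0)
      with 0 show ?case by simp
    next
      case (Suc j)
      have "take k A ! Suc j = take (k - 1) A ! j" using shift by (metis nth_Cons_Suc)
      with Suc show ?case by simp
    qed
    with that(2) n(2) show ?thesis by (auto simp: list_eq_iff_nth_eq)
  qed
  \<comment> \<open>By \<open>heads\<close>, a T at index \<open>n - 1\<close> makes that index odd,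
    hence \<open>n\<close> even, and this is the excluded string.\<close>
  have last_letter: "A \<noteq> replicate (n - 1) H @ [T]"
  proof
    assume A: "A = replicate (n - 1) H @ [T]"
    then have "A ! (n - 1) = T" by (simp add: nth_append)
    moreover have "even (n - 1)" using exceptional A n(1) by auto
    ultimately show False
      using heads n(1,2) by (simp add: heads_at_odd_iff)
  qed
  \<comment> \<open>This keeps Bob's string from being a prefix of H followed by letters of
    \<open>A\<close>. The two choices of the last letter give the two excluded strings.\<close>
  have take_n: "take (n - 1) A \<noteq> replicate (n - 1) H"
  proof
    assume *: "take (n - 1) A = replicate (n - 1) H"
    have "A = take (n - 1) A @ [A ! (n - 1)]"
      using n(1,2) take_Suc_conv_app_nth[of "n - 1" A] by simp
    with * last_letter n(1,3) show False
      by (cases n; cases "A ! (n - 1)") (auto simp: replicate_append_same)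
  qed
  have B_free: "\<not> sublist (replicate n H) (H # take k A)" for k
  proof
    assume "sublist (replicate n H) (H # take k A)"
    then have "prefix (replicate n H) (H # take k A) \<or> sublist (replicate n H) (take k A)"
      by (simp add: sublist_Cons_right)
    then show False
    proof
      assume "prefix (replicate n H) (H # take k A)"
      then have "prefix (replicate (n - 1) H) (take k A)"
        using n(1) by (cases n) auto
      then have "prefix (replicate (n - 1) H) A"
        using prefix_order.trans take_is_prefix by blast
      then show False
        using take_n by (auto simp: prefix_def)
    next
      assume "sublist (replicate n H) (take k A)"
      then have "sublist (replicate n H) A"
        using sublist_take sublist_order.order_trans by blast
      then show False
        using sublist_length_ge_eq[of "replicate n H" A] n by simp
    qed
  qed
  have A_free: "\<not> sublist A (H # take (k - 1) A)" if "k \<le> n" "k \<noteq> 0" for k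
  proof
    assume "sublist A (H # take (k - 1) A)"
    then have A: "A = H # take (k - 1) A"
      using that n(2) by (intro sublist_length_ge_eq) auto
    then have "length A = Suc (length (take (k - 1) A))"
      by (metis length_Cons)
    then have "n = k" using that n(2) by simp
    with eq_replicate[of n] A n show False by simp
  qed
  \<comment> \<open>At \<open>k = 0\<close> the right side would be \<open>[H]\<close>, whereas the
    output is empty. At \<open>Suc n\<close> it is H followed by all of \<open>A\<close>.\<close>
  have outputs: "game_output A (replicate n H) k = H # take (k - 1) A" if "k \<noteq> 0" "k \<le> Suc n" for k
    using that
  proof (induction k)
    case (Suc k)
    show ?case
    proof (cases "k = 0")
      case True
      have "A \<noteq> []" using n by auto
      moreover have "overlap A [] = 0" using overlap_le_length[of A "[]"] \<open>A \<noteq> []\<close> by simp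
      ultimately show ?thesis
        using True n heads
        by (auto simp: game_over_def next_letter_def heads_at_odd_iff)
    next
      case False
      let ?s = "H # take (k - 1) A"
      have "k \<le> n" and IH: "game_output A (replicate n H) k = ?s"
        using Suc False by auto
      have "A ! (k - 1) = next_letter (if even k then A else replicate n H) ?s"
      proof (cases "even k")
        case False
        then have "even (k - 1)" by simp
        with heads n False \<open>k \<le> n\<close> \<open>k \<noteq> 0\<close> show ?thesis
          by (auto simp: heads_at_odd_iff)
      next
        case True
        have "A \<noteq> []" using n by auto
        \<comment> \<open>The tail of \<open>?s\<close> is a prefix of \<open>A\<close>, and a
          longer overlap would have to use all of \<open>?s\<close>.\<close>
        have "k - 1 \<le> overlap A ?s"
          using n(2) \<open>k \<le> n\<close> \<open>k \<noteq> 0\<close> by (intro overlap_ge) (auto simp: suffix_ConsI)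
        moreover have "overlap A ?s \<le> k"
          using overlap_le_length[OF \<open>A \<noteq> []\<close>, of ?s] \<open>k \<le> n\<close> \<open>k \<noteq> 0\<close> n(2) by simp
        ultimately consider "overlap A ?s = k - 1" | "overlap A ?s = k" by linarith
        then show ?thesis
        proof cases
          case 1
          with True show ?thesis by (simp add: next_letter_def)
        next
          \<comment> \<open>In this case the output is all H, and Alice overtakes the expected overlap by one.\<close>
          case 2
          have "k < n" using overlap_less_length[OF \<open>A \<noteq> []\<close>, of ?s] 2 n(2) by simp
          have "suffix (take k A) ?s" using overlap_suffix[OF \<open>A \<noteq> []\<close>, of ?s] 2 by simp
          then have "?s = take k A"
            using \<open>k < n\<close> n(2) \<open>k \<noteq> 0\<close> by (intro sublist_length_ge_eq[symmetric]) auto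
          then have "take k A = replicate k H"
            using eq_replicate \<open>k \<le> n\<close> \<open>k \<noteq> 0\<close> by blast
          then have "A ! (k - 1) = H"
            using \<open>k \<noteq> 0\<close> nth_take[of "k - 1" k A] by simp
          moreover have "A ! k = H"
            using heads \<open>k < n\<close> n(2) True by (simp add: heads_at_odd_iff)
          ultimately show ?thesis using 2 True by (simp add: next_letter_def)
        qed
      qed
      moreover have "\<not> game_over A (replicate n H) ?s"
        using A_free B_free \<open>k \<le> n\<close> \<open>k \<noteq> 0\<close> by (simp add: game_over_def)
      moreover have "take k A = take (k - 1) A @ [A ! (k - 1)]"
        using take_Suc_conv_app_nth[of "k - 1" A] \<open>k \<le> n\<close> \<open>k \<noteq> 0\<close> n(2) by simp
      ultimately show ?thesis
        using IH by simp
    qed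
  qed simp
  have "\<not> sublist (replicate n H) (game_output A (replicate n H) j)" if "j \<le> Suc n" for j
    using outputs[OF _ that] B_free n(1) by (cases "j = 0") auto
  moreover have "sublist A (game_output A (replicate n H) (Suc n))"
    using outputs[of "Suc n"] n(2) by (simp add: sublist_Cons_right del: game_output.simps)
  ultimately show ?thesis
    unfolding alice_wins_def by blast
qed

section \<open>When Bob's string appears and when it cannot\<close>

lemma bob_wins_exceptional:
  assumes "even n" "n \<noteq> 0" "A = replicate (n - 1) H @ [T]"
  shows "bob_wins A (replicate n H)"
proof -
  have len: "length A = n" using assms by simp
  have take_A: "take k A = replicate k H" if "k < n" for k
    using that assms(3) by (simp add: min_def)
  have A_free: "\<not> sublist A (replicate k H)" for k
    using assms(3) by (auto dest!: set_mono_sublist split: if_splits)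
  have outputs: "game_output A (replicate n H) k = replicate k H" if "k \<le> n" for k
    using that
  proof (induction k)
    case (Suc k)
    then have IH: "game_output A (replicate n H) k = replicate k H" and "k < n" by auto
    have "\<not> game_over A (replicate n H) (replicate k H)"
      using A_free \<open>k < n\<close> by (auto simp: game_over_def dest: sublist_length_le)
    moreover have "next_letter (if even k then A else replicate n H) (replicate k H) = H"
    proof (cases "even k")
      case True
      \<comment> \<open>Alice moves at even \<open>k\<close>, but \<open>n - 1\<close> is odd, so
        she never reaches her T.\<close>
      then have "k < n - 1" using \<open>k < n\<close> assms(1) by presburger
      moreover have "overlap A (replicate k H) = k"
        using overlap_take[of k A] take_A[OF \<open>k < n\<close>] len \<open>k < n\<close> by simp
      ultimately show ?thesis using True assms(3) by (simp add: next_letter_def nth_append)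
    qed (use assms in simp)
    ultimately show ?case
      using IH by (simp add: replicate_append_same)
  qed simp
  show ?thesis
    unfolding bob_wins_def using outputs A_free by (intro exI[of _ n]) auto
qed

text \<open>The overlap is at least \<open>q\<close>. At exactly \<open>q\<close> the next letter
  would be T; above \<open>q\<close> but at most \<open>m\<close>, the matched prefix would put that
  T inside the run of H.\<close>

lemma overlap_gt_heads:
  assumes "q \<le> m" "q < length A" "take q A = replicate q H" "A ! q = T"
    and "suffix (replicate m H) s" "next_letter A s = H"
  shows "m < overlap A s"
proof (rule ccontr)
  assume "\<not> m < overlap A s"
  have "A \<noteq> []" using assms(2) by auto
  have "suffix (replicate q H) (replicate m H)"
    using assms(1) by (metis suffixI le_add_diff_inverse2 replicate_add)
  then have "q \<le> overlap A s"
    using assms by (intro overlap_ge) (auto intro: suffix_order.trans)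
  moreover have "overlap A s \<noteq> q"
    using assms(4,6) by (auto simp: next_letter_def)
  ultimately have "q < overlap A s" by simp
  have "suffix (take (overlap A s) A) (replicate m H)"
    using overlap_suffix[OF \<open>A \<noteq> []\<close>, of s] assms(5) \<open>\<not> m < overlap A s\<close>
    by (auto elim: suffix_length_suffix)
  then have "set (take (overlap A s) A) \<subseteq> {H}"
    using set_mono_suffix set_replicate_conv_if by fastforce
  moreover have "T \<in> set (take (overlap A s) A)"
    using \<open>q < overlap A s\<close> assms(2,4) by (auto simp: in_set_conv_nth)
  ultimately show False by auto
qed

lemma first_T:
  assumes "A \<noteq> replicate (length A) H"
  obtains q where "q < length A" "take q A = replicate q H" "A ! q = T"
proof -
  from assms have "\<exists>q. q < length A \<and> A ! q \<noteq> H"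
    by (auto simp: list_eq_iff_nth_eq)
  then obtain q where q: "q < length A" "A ! q \<noteq> H" and "\<forall>j<q. \<not> (j < length A \<and> A ! j \<noteq> H)"
    unfolding exists_least_iff[of "\<lambda>q. q < length A \<and> A ! q \<noteq> H"] by blast
  then have "take q A = replicate q H"
    by (intro nth_equalityI) auto
  moreover have "A ! q = T"
    using q(2) letter.exhaust by blast
  ultimately show thesis
    using that q(1) by blast
qed

lemma bob_string_never_appears:
  assumes n: "n \<noteq> 0" "length A = n" "A \<noteq> replicate n H" "A \<noteq> replicate (n - 1) H @ [T]"
  shows "\<not> sublist (replicate n H) (game_output A (replicate n H) k)"
proof (induction k)
  case (Suc k)
  let ?B = "replicate n H"
  let ?out = "game_output A ?B"
  obtain q where q: "q < length A" "take q A = replicate q H" "A ! q = T"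
    using first_T n(2,3) by metis
  \<comment> \<open>Otherwise \<open>A\<close> would be all H but for a final T. The resulting bound
    lets \<open>overlap_gt_heads\<close> apply to runs of \<open>n - 1\<close> and of
    \<open>n - 2\<close> letters H.\<close>
  have "q \<noteq> n - 1"
    using take_Suc_conv_app_nth[of "n - 1" A] q n by auto
  then have "q + 2 \<le> n" using q(1) n(2) by simp
  have "A \<noteq> []" using n by auto
  show ?case
  proof
    assume sub: "sublist ?B (?out (Suc k))"
    \<comment> \<open>A finished game keeps its output, so Bob's string would have been there after
      \<open>k\<close> turns already.\<close>
    then have not_over: "\<not> game_over A ?B (?out k)"
      using Suc by auto
    define x where "x = next_letter (if even k then A else ?B) (?out k)"
    have out: "?out (Suc k) = ?out k @ [x]"
      using game_output_Suc[OF not_over] by (simp add: x_def)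
    have "suffix ?B (?out k @ [x])"
      using sub[unfolded out] Suc by (simp only: sublist_snoc) simp
    moreover have "?B = replicate (n - 1) H @ [H]"
      using n(1) by (cases n) (auto simp: replicate_append_same)
    ultimately have heads: "suffix (replicate (n - 1) H) (?out k)" "x = H"
      by auto
    show False
    proof (cases "even k")
      case True
      then have "next_letter A (?out k) = H" using heads(2) by (simp add: x_def)
      with heads(1) q \<open>q + 2 \<le> n\<close> have "n - 1 < overlap A (?out k)"
        by (intro overlap_gt_heads[of q]) auto
      with overlap_less_length[OF \<open>A \<noteq> []\<close>, of "?out k"] n(2) show False by simp
    next
      case False
      \<comment> \<open>If Bob completes the run, the argument moves back one turn, to Alice's
        letter just before his.\<close>
      then obtain j where j: "k = Suc j" "even j" by (cases k) auto
      have not_over': "\<not> game_over A ?B (?out j)"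
        using not_over j by auto
      define y where "y = next_letter A (?out j)"
      have out': "?out k = ?out j @ [y]"
        using game_output_Suc[OF not_over'] j by (simp add: y_def)
      have "replicate (n - 1) H = replicate (n - 2) H @ [H]"
        using \<open>q + 2 \<le> n\<close> replicate_append_same[of "n - 2" H] replicate_Suc[of "n - 2" H]
          Suc_diff_Suc[of 1 n] by (simp add: numeral_2_eq_2 del: replicate_Suc)
      with heads(1) out' have "suffix (replicate (n - 2) H) (?out j)" "y = H"
        by auto
      with q \<open>q + 2 \<le> n\<close> have "n - 2 < overlap A (?out j)"
        unfolding y_def by (intro overlap_gt_heads[of q]) auto
      moreover have "overlap A (?out j) < n"
        using overlap_less_length[OF \<open>A \<noteq> []\<close>, of "?out j"] n(2) by simp
      \<comment> \<open>Her overlap was the largest possible, so her letter completed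
        \<open>A\<close> and the game ended before Bob's move.\<close>
      ultimately have "Suc (overlap A (?out j)) = n" by simp
      then have "suffix A (?out k)"
        using suffix_append_next_letter[OF \<open>A \<noteq> []\<close>, of "?out j"] out' n(2) by (simp add: y_def)
      with not_over show False by (auto simp: game_over_def)
    qed
  qed
qed (use n in simp)

theorem lemma20:
  fixes n :: nat and A B :: "letter list"
  assumes "n \<ge> 1"
    and "B = replicate n H"
    and "length A = n"
    and "A \<noteq> B"
  shows "(bob_wins A B \<longleftrightarrow> even n \<and> A = replicate (n - 1) H @ [T])
    \<and> (\<not> (even n \<and> A = replicate (n - 1) H @ [T]) \<longrightarrow>
        (alice_wins A B \<longleftrightarrow> heads_at_even A \<or> heads_at_odd A))
    \<and> (\<not> (even n \<and> A = replicate (n - 1) H @ [T]) \<and> \<not> (heads_at_even A \<or> heads_at_odd A) \<longrightarrow>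
        infinite_game A B)"
proof -
  have n: "n \<noteq> 0" "length A = n" "A \<noteq> replicate n H" using assms by auto
  let ?exc = "even n \<and> A = replicate (n - 1) H @ [T]"
  have alice_imp: "heads_at_even A \<or> heads_at_odd A" if "alice_wins A B"
    using that sublist_game_output_heads[OF n(1)] assms(2) unfolding alice_wins_def by blast
  have heads_imp: "alice_wins A B" if "heads_at_even A \<or> heads_at_odd A" "\<not> ?exc"
    using that alice_wins_heads_at_even[OF n] alice_wins_heads_at_odd[OF n] assms(2) by blast
  have B_free: "\<not> sublist B (game_output A B k)"
    if "\<not> ?exc" "\<not> (heads_at_even A \<or> heads_at_odd A)" for k
  proof -
    \<comment> \<open>For odd \<open>n\<close> the final T has an even index counted from 0, which
      \<open>heads_at_even\<close> leaves free.\<close>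
    have "heads_at_even A" if "A = replicate (n - 1) H @ [T]" "odd n"
      using that by (cases n) (auto simp: heads_at_even_iff nth_append less_Suc_eq)
    with that have "A \<noteq> replicate (n - 1) H @ [T]" by blast
    from bob_string_never_appears[OF n this] show ?thesis using assms(2) by simp
  qed
  \<comment> \<open>Outside the exceptional case, either Alice wins, so Bob does not, or Bob's
    string never appears.\<close>
  have "bob_wins A B \<longleftrightarrow> ?exc"
    using bob_wins_exceptional[OF _ n(1)] assms(2) heads_imp alice_wins_not_bob_wins B_free
    unfolding bob_wins_def by metis
  moreover have "infinite_game A B" if "\<not> ?exc" "\<not> (heads_at_even A \<or> heads_at_odd A)"
    unfolding infinite_game_def game_over_def
    using B_free[OF that] sublist_game_output_heads[OF n(1)] that(2) assms(2) by blast
  ultimately show ?thesis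
    using alice_imp heads_imp by blast
qed

end
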